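(* Let $L$ be a limit group whose cyclic JSJ decomposition is $L=A*_{\langle z\rangle}B$, where $A$ and $B$ are both rigid vertex groups and $\langle z\rangle$ is maximal abelian in both $A$ and $B$. Let $\boldsymbol{g}$ be a finite generating set of $L$ and let $(\mathbb{F}_\ell,\eta)$, where $\mathbb{F}_\ell$ is a free group of rank $\ell\ge2$, be a strict maximal $\boldsymbol{g}$-shortening quotient of $L$. Then for every finite generating set $\boldsymbol{u}$ of $L$ there is a $\boldsymbol{u}$-shortening quotient of $L$ that is SQ-isomorphic to $(\mathbb{F}_\ell,\eta)$.
   Context: $\mathbb{F}$ is a fixed f.g. free group with a fixed free basis, and $|\cdot|$ is word length in that basis. A sequence of homomorphisms $h_n:G\to\mathbb{F}$ is stable if for each $g\in G$ either $h_n(g)=1$ for all large $n$ or $h_n(g)\neq1$ for all large $n$; its stable kernel is the set of $g$ with $h_n(g)=1$ for all large $n$. A limit group is a quotient of a f.g. group by the stable kernel of such a sequence. JSJ decompositions are cyclic JSJ decompositions in the sense of Rips and Sela; vertex groups are rigid, surface or abelian. For a freely indecomposable limit group $G$, $Mod(G)\le Aut(G)$ is generated by inner automorphisms, Dehn twists along edges of the cyclic JSJ decomposition, modular (mapping class) automorphisms of surface vertex groups, and automorphisms of abelian vertex groups that fix the adjacent edge groups, extended to $G$. Let $\boldsymbol{g}=(g_1,\dots,g_k)$ be a finite generating set of $G$. A homomorphism $h:G\to\mathbb{F}$ is $\boldsymbol{g}$-shortest if $\max_i|h(g_i)|\le\max_i|\iota_c\circ h\circ\varphi(g_i)|$ for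 all $c\in\mathbb{F}$ and $\varphi\in Mod(G)$, where $\iota_c$ is conjugation by $c$. A $\boldsymbol{g}$-shortening quotient of $G$ is a pair $(Q,\eta)$ with $\eta:G\to Q$ a quotient map whose kernel is the stable kernel of a stable sequence of $\boldsymbol{g}$-shortest homomorphisms. Shortening quotients for $\boldsymbol{g}$ are ordered by: $(Q,\eta)\le(M,\pi)$ iff $\eta=\sigma\circ\pi$ for some epimorphism $\sigma:M\to Q$; a maximal $\boldsymbol{g}$-shortening quotient is a maximal element. An SQ-isomorphism between shortening quotients $(M,\pi)$ and $(Q,\eta)$ of $G$ (possibly with respect to different generating sets) is a group isomorphism $\sigma:M\to Q$ such that $\eta\circ\varphi=\sigma\circ\pi$ for some $\varphi\in Mod(G)$. $(Q,\eta)$ is strict if, with respect to the cyclic JSJ decomposition of $G$: (i) for every rigid vertex group $G_v$, replacing each neighbouring abelian vertex group by the direct summand of its edge groups and letting $\tilde G_v$ be generated by $G_v$ and the centralisers of the edge groups connected to $G_v$ in the new graph of groups, $\eta|_{\tilde G_v}$ is injective; (ii) for every surface vertex group $S$, $\eta(S)$ is non-abelian and boundary elements of $S$ have non-trivial images; (iii) for every abelian vertex group $A'$, $\eta$ is injective on the subgroup of $A'$ generated by all edge groups connected to the vertex stabilised by $A'$. *)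

theory Defs
  imports "HOL-Algebra.Group_Action" "HOL-Algebra.Generated_Groups"
begin

section \<open>Words, presentations and free bases\<close>

text \<open>A letter \<open>(x, True)\<close> stands for the generator \<open>x\<close>, and \<open>(x, False)\<close> for its inverse.\<close>

type_synonym 'x word = "('x \<times> bool) list"

definition word_val :: "('a, 'm) monoid_scheme \<Rightarrow> ('x \<Rightarrow> 'a) \<Rightarrow> 'x word \<Rightarrow> 'a" where
  "word_val G f w =
     foldr (\<lambda>(x, b) r. (if b then f x else inv\<^bsub>G\<^esub> (f x)) \<otimes>\<^bsub>G\<^esub> r) w \<one>\<^bsub>G\<^esub>"

definition words_over :: "'x set \<Rightarrow> 'x word set" where
  "words_over Y = {w. fst ` set w \<subseteq> Y}"

text \<open>The words that represent the identity in the group with relators \<open>R\<close>.\<close>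

inductive_set trivial_words :: "'x word set \<Rightarrow> 'x word set" for R where
  empty: "[] \<in> trivial_words R"
| ins_pair: "u @ v \<in> trivial_words R \<Longrightarrow> u @ [(x, b), (x, \<not> b)] @ v \<in> trivial_words R"
| del_pair: "u @ [(x, b), (x, \<not> b)] @ v \<in> trivial_words R \<Longrightarrow> u @ v \<in> trivial_words R"
| ins_rel: "u @ v \<in> trivial_words R \<Longrightarrow> r \<in> R \<Longrightarrow> u @ r @ v \<in> trivial_words R"
| del_rel: "u @ r @ v \<in> trivial_words R \<Longrightarrow> r \<in> R \<Longrightarrow> u @ v \<in> trivial_words R"

definition has_presentation ::
  "('a, 'm) monoid_scheme \<Rightarrow> 'x set \<Rightarrow> ('x \<Rightarrow> 'a) \<Rightarrow> 'x word set \<Rightarrow> bool" where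
  "has_presentation G Y f R \<longleftrightarrow>
     group G \<and> f ` Y \<subseteq> carrier G \<and> generate G (f ` Y) = carrier G \<and> R \<subseteq> words_over Y \<and>
     (\<forall>w \<in> words_over Y. word_val G f w = \<one>\<^bsub>G\<^esub> \<longleftrightarrow> w \<in> trivial_words R)"

definition free_basis :: "('a, 'm) monoid_scheme \<Rightarrow> 'a set \<Rightarrow> bool" where
  "free_basis G Y \<longleftrightarrow> has_presentation G Y (\<lambda>x. x) {}"

definition free_of_rank :: "('a, 'm) monoid_scheme \<Rightarrow> nat \<Rightarrow> bool" where
  "free_of_rank G n \<longleftrightarrow> (\<exists>Y. free_basis G Y \<and> finite Y \<and> card Y = n)"

definition word_length :: "('a, 'm) monoid_scheme \<Rightarrow> 'a set \<Rightarrow> 'a \<Rightarrow> nat" where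
  "word_length G Y g =
     (LEAST n. \<exists>w \<in> words_over Y. length w = n \<and> word_val G (\<lambda>x. x) w = g)"

definition finite_generating_set :: "('a, 'm) monoid_scheme \<Rightarrow> 'a set \<Rightarrow> bool" where
  "finite_generating_set G S \<longleftrightarrow> finite S \<and> S \<subseteq> carrier G \<and> generate G S = carrier G"

text \<open>The internal amalgamated product \<open>A *\<^sub>C B\<close>: the group is presented by the disjoint
  union of \<open>A\<close> and \<open>B\<close>, the multiplication tables of \<open>A\<close> and \<open>B\<close>, and the identification of
  the two copies of \<open>C\<close>.\<close>

definition amalgam_relators ::
  "('a, 'm) monoid_scheme \<Rightarrow> 'a set \<Rightarrow> 'a set \<Rightarrow> 'a set \<Rightarrow> ('a + 'a) word set" where
  "amalgam_relators G A B C =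
     {[(Inl a, True), (Inl a', True), (Inl (a \<otimes>\<^bsub>G\<^esub> a'), False)] | a a'. a \<in> A \<and> a' \<in> A} \<union>
     {[(Inr b, True), (Inr b', True), (Inr (b \<otimes>\<^bsub>G\<^esub> b'), False)] | b b'. b \<in> B \<and> b' \<in> B} \<union>
     {[(Inl c, True), (Inr c, False)] | c. c \<in> C}"

definition amalgamated_product ::
  "('a, 'm) monoid_scheme \<Rightarrow> 'a set \<Rightarrow> 'a set \<Rightarrow> 'a set \<Rightarrow> bool" where
  "amalgamated_product G A B C \<longleftrightarrow>
     subgroup A G \<and> subgroup B G \<and> subgroup C G \<and> C \<subseteq> A \<inter> B \<and>
     has_presentation G (Inl ` A \<union> Inr ` B) (case_sum (\<lambda>x. x) (\<lambda>x. x)) (amalgam_relators G A B C)"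

definition freely_indecomposable :: "('a, 'm) monoid_scheme \<Rightarrow> bool" where
  "freely_indecomposable G \<longleftrightarrow>
     (\<forall>A B. amalgamated_product G A B {\<one>\<^bsub>G\<^esub>} \<longrightarrow> A = {\<one>\<^bsub>G\<^esub>} \<or> B = {\<one>\<^bsub>G\<^esub>})"


section \<open>Abelian subgroups, conjugates and direct summands\<close>

definition abelian_in :: "('a, 'm) monoid_scheme \<Rightarrow> 'a set \<Rightarrow> bool" where
  "abelian_in G H \<longleftrightarrow> (\<forall>x \<in> H. \<forall>y \<in> H. x \<otimes>\<^bsub>G\<^esub> y = y \<otimes>\<^bsub>G\<^esub> x)"

definition maximal_abelian_in :: "('a, 'm) monoid_scheme \<Rightarrow> 'a set \<Rightarrow> 'a set \<Rightarrow> bool" where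
  "maximal_abelian_in G C A \<longleftrightarrow>
     subgroup C G \<and> C \<subseteq> A \<and> abelian_in G C \<and>
     (\<forall>H. subgroup H G \<and> abelian_in G H \<and> C \<subseteq> H \<and> H \<subseteq> A \<longrightarrow> H = C)"

definition cyclic_in :: "('a, 'm) monoid_scheme \<Rightarrow> 'a set \<Rightarrow> bool" where
  "cyclic_in G H \<longleftrightarrow> (\<exists>c \<in> carrier G. H = generate G {c})"

definition conj_elt :: "('a, 'm) monoid_scheme \<Rightarrow> 'a \<Rightarrow> 'a \<Rightarrow> 'a" where
  "conj_elt G c x = c \<otimes>\<^bsub>G\<^esub> x \<otimes>\<^bsub>G\<^esub> inv\<^bsub>G\<^esub> c"

definition direct_summand :: "('a, 'm) monoid_scheme \<Rightarrow> 'a set \<Rightarrow> 'a set \<Rightarrow> bool" where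
  "direct_summand G D H \<longleftrightarrow>
     subgroup D G \<and> D \<subseteq> H \<and>
     (\<exists>K. subgroup K G \<and> K \<subseteq> H \<and> D \<inter> K = {\<one>\<^bsub>G\<^esub>} \<and> D <#>\<^bsub>G\<^esub> K = H)"


section \<open>Trees with a group action\<close>

text \<open>Splittings are represented by their Bass-Serre trees. Edges are ordered pairs of vertices;
  each geometric edge occurs in both orientations.\<close>

record ('g, 'v) gtree =
  tverts :: "'v set"
  tedges :: "('v \<times> 'v) set"
  tact   :: "'g \<Rightarrow> 'v \<Rightarrow> 'v"

definition is_tree :: "'v set \<Rightarrow> ('v \<times> 'v) set \<Rightarrow> bool" where
  "is_tree V E \<longleftrightarrow>
     V \<noteq> {} \<and> E \<subseteq> V \<times> V \<and> sym E \<and> irrefl E \<and> (\<forall>x \<in> V. \<forall>y \<in> V. (x, y) \<in> E\<^sup>*) \<and>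
     \<not> (\<exists>xs. 3 \<le> length xs \<and> distinct xs \<and> successively (\<lambda>x y. (x, y) \<in> E) xs \<and>
            (last xs, hd xs) \<in> E)"

definition tree_action :: "('g, 'm) monoid_scheme \<Rightarrow> ('g, 'v) gtree \<Rightarrow> bool" where
  "tree_action G T \<longleftrightarrow>
     group_action G (tverts T) (tact T) \<and> is_tree (tverts T) (tedges T) \<and>
     (\<forall>g \<in> carrier G. \<forall>(x, y) \<in> tedges T.
        (tact T g x, tact T g y) \<in> tedges T \<and> \<not> (tact T g x = y \<and> tact T g y = x))"

definition vstab :: "('g, 'm) monoid_scheme \<Rightarrow> ('g, 'v) gtree \<Rightarrow> 'v \<Rightarrow> 'g set" where
  "vstab G T v = stabilizer G (tact T) v"

definition estab :: "('g, 'm) monoid_scheme \<Rightarrow> ('g, 'v) gtree \<Rightarrow> 'v \<Rightarrow> 'v \<Rightarrow> 'g set" where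
  "estab G T v w = vstab G T v \<inter> vstab G T w"

definition setstab :: "('g, 'm) monoid_scheme \<Rightarrow> ('g, 'v) gtree \<Rightarrow> 'v set \<Rightarrow> 'g set" where
  "setstab G T U = {g \<in> carrier G. tact T g ` U = U}"

definition nbrs :: "('g, 'v) gtree \<Rightarrow> 'v \<Rightarrow> 'v set" where
  "nbrs T v = {w. (v, w) \<in> tedges T}"

definition induced_connected :: "('g, 'v) gtree \<Rightarrow> 'v set \<Rightarrow> bool" where
  "induced_connected T W \<longleftrightarrow> (\<forall>x \<in> W. \<forall>y \<in> W. (x, y) \<in> (tedges T \<inter> W \<times> W)\<^sup>*)"

definition minimal_action :: "('g, 'm) monoid_scheme \<Rightarrow> ('g, 'v) gtree \<Rightarrow> bool" where
  "minimal_action G T \<longleftrightarrow>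
     (\<forall>W. W \<subseteq> tverts T \<and> W \<noteq> {} \<and> induced_connected T W \<and>
          (\<forall>g \<in> carrier G. tact T g ` W \<subseteq> W) \<longrightarrow> W = tverts T)"

definition elliptic :: "('g, 'm) monoid_scheme \<Rightarrow> ('g, 'v) gtree \<Rightarrow> 'g set \<Rightarrow> bool" where
  "elliptic G T H \<longleftrightarrow> (\<exists>v \<in> tverts T. H \<subseteq> vstab G T v)"

text \<open>Edge groups are infinite cyclic, and (Sela's convention for limit groups) non-cyclic
  abelian subgroups are elliptic.\<close>

definition cyclic_splitting :: "('g, 'm) monoid_scheme \<Rightarrow> ('g, 'v) gtree \<Rightarrow> bool" where
  "cyclic_splitting G T \<longleftrightarrow>
     tree_action G T \<and> minimal_action G T \<and>
     (\<forall>(v, w) \<in> tedges T. cyclic_in G (estab G T v w) \<and> infinite (estab G T v w)) \<and>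
     (\<forall>H. subgroup H G \<and> abelian_in G H \<and> \<not> cyclic_in G H \<longrightarrow> elliptic G T H)"

definition edge_orbit :: "('g, 'm) monoid_scheme \<Rightarrow> ('g, 'v) gtree \<Rightarrow> 'v \<Rightarrow> 'v \<Rightarrow> ('v \<times> 'v) set" where
  "edge_orbit G T v w =
     {(tact T g v, tact T g w) | g. g \<in> carrier G} \<union> {(tact T g w, tact T g v) | g. g \<in> carrier G}"

text \<open>A non-trivial splitting \<open>A *\<^sub>C B\<close> or \<open>A *\<^sub>C\<close> with one edge.\<close>

definition elementary_splitting :: "('g, 'm) monoid_scheme \<Rightarrow> ('g, 'v) gtree \<Rightarrow> bool" where
  "elementary_splitting G T \<longleftrightarrow>
     cyclic_splitting G T \<and> (\<exists>(v, w) \<in> tedges T. tedges T = edge_orbit G T v w)"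

definition hyperbolic_in ::
  "('g, 'm) monoid_scheme \<Rightarrow> ('g, 'v) gtree \<Rightarrow> ('g, 'w) gtree \<Rightarrow> bool" where
  "hyperbolic_in G T T' \<longleftrightarrow> (\<exists>(v, w) \<in> tedges T. \<not> elliptic G T' (estab G T v w))"

text \<open>An equivariant map between vertex sets extends uniquely to an equivariant map from a
  subdivision of the first tree that is linear on edges.\<close>

definition equivariant ::
  "('g, 'm) monoid_scheme \<Rightarrow> ('g, 'v) gtree \<Rightarrow> ('g, 'w) gtree \<Rightarrow> ('v \<Rightarrow> 'w) \<Rightarrow> bool" where
  "equivariant G T T' p \<longleftrightarrow>
     p ` tverts T \<subseteq> tverts T' \<and>
     (\<forall>g \<in> carrier G. \<forall>x \<in> tverts T. p (tact T g x) = tact T' g (p x))"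

definition dominates ::
  "('g, 'm) monoid_scheme \<Rightarrow> ('g, 'v) gtree \<Rightarrow> ('g, 'w) gtree \<Rightarrow> bool" where
  "dominates G T T' \<longleftrightarrow> (\<exists>p. equivariant G T T' p)"

text \<open>A map collapsing each component of a union of edge orbits to a point.\<close>

definition collapse_map ::
  "('g, 'm) monoid_scheme \<Rightarrow> ('g, 'v) gtree \<Rightarrow> ('g, 'w) gtree \<Rightarrow> ('v \<Rightarrow> 'w) \<Rightarrow> bool" where
  "collapse_map G T T' p \<longleftrightarrow>
     equivariant G T T' p \<and> p ` tverts T = tverts T' \<and>
     (\<forall>(x, y) \<in> tedges T. p x = p y \<or> (p x, p y) \<in> tedges T') \<and>
     (\<forall>v \<in> tverts T'. induced_connected T {x \<in> tverts T. p x = v})"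

text \<open>Here valence is counted in the quotient graph; loops are exempt.\<close>

definition reduced_splitting :: "('g, 'm) monoid_scheme \<Rightarrow> ('g, 'v) gtree \<Rightarrow> bool" where
  "reduced_splitting G T \<longleftrightarrow>
     (\<forall>(v, w) \<in> tedges T.
        let link = (\<lambda>u. (\<lambda>g. tact T g u) ` vstab G T v) ` nbrs T v
        in w \<notin> orbit G (tact T) v \<and> finite link \<and> card link \<le> 2
           \<longrightarrow> estab G T v w \<noteq> vstab G T v)"

text \<open>The Bass-Serre tree of \<open>A *\<^sub>C B\<close>: vertices are the left cosets of \<open>A\<close> (tagged \<open>False\<close>)
  and of \<open>B\<close> (tagged \<open>True\<close>), and \<open>g\<close> contributes the edge from \<open>gA\<close> to \<open>gB\<close>.\<close>

definition bass_serre_tree ::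
  "('g, 'm) monoid_scheme \<Rightarrow> 'g set \<Rightarrow> 'g set \<Rightarrow> ('g, bool \<times> 'g set) gtree" where
  "bass_serre_tree G A B =
     (let V = {(False, g <#\<^bsub>G\<^esub> A) | g. g \<in> carrier G} \<union> {(True, g <#\<^bsub>G\<^esub> B) | g. g \<in> carrier G};
          E = {((False, g <#\<^bsub>G\<^esub> A), (True, g <#\<^bsub>G\<^esub> B)) | g. g \<in> carrier G}
      in \<lparr>tverts = V, tedges = E \<union> E\<inverse>, tact = (\<lambda>g. \<lambda>(b, U) \<in> V. (b, g <#\<^bsub>G\<^esub> U))\<rparr>)"


section \<open>Surface vertex groups\<close>

datatype surface_gen = Bdry nat | HandleA nat | HandleB nat | Crosscap nat

definition surface_gens :: "bool \<Rightarrow> nat \<Rightarrow> nat \<Rightarrow> surface_gen set" where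
  "surface_gens orient k m =
     Bdry ` {..<m} \<union>
     (if orient then HandleA ` {..<k} \<union> HandleB ` {..<k} else Crosscap ` {..<k})"

definition surface_relator :: "bool \<Rightarrow> nat \<Rightarrow> nat \<Rightarrow> surface_gen word" where
  "surface_relator orient k m =
     map (\<lambda>i. (Bdry i, True)) [0..<m] @
     concat (map (\<lambda>j. if orient
        then [(HandleA j, True), (HandleB j, True), (HandleA j, False), (HandleB j, False)]
        else [(Crosscap j, True), (Crosscap j, True)]) [0..<k])"

text \<open>Compact surfaces of negative Euler characteristic other than the pair of pants (which
  carries no essential simple closed curve and is therefore rigid).\<close>

definition surface_type :: "bool \<Rightarrow> nat \<Rightarrow> nat \<Rightarrow> bool" where
  "surface_type orient k m \<longleftrightarrow>
     (if orient then 2 - 2 * int k - int m < 0 \<and> (k, m) \<noteq> (0, 3)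
      else 1 \<le> k \<and> 2 - int k - int m < 0)"

definition boundary_subgroup ::
  "('g, 'm) monoid_scheme \<Rightarrow> (surface_gen \<Rightarrow> 'g) \<Rightarrow> nat \<Rightarrow> 'g \<Rightarrow> 'g set" where
  "boundary_subgroup G f i q = conj_elt G q ` generate G {f (Bdry i)}"

text \<open>A quadratically hanging vertex group: the stabiliser of \<open>v\<close> is a surface group, incident
  edge groups are peripheral, and every boundary component meets an edge group.\<close>

definition surface_structure ::
  "('g, 'm) monoid_scheme \<Rightarrow> ('g, 'v) gtree \<Rightarrow> 'v \<Rightarrow> bool \<Rightarrow> nat \<Rightarrow> nat \<Rightarrow> (surface_gen \<Rightarrow> 'g) \<Rightarrow> bool"
  where
  "surface_structure G T v orient k m f \<longleftrightarrow>
     surface_type orient k m \<and>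
     has_presentation (G\<lparr>carrier := vstab G T v\<rparr>) (surface_gens orient k m) f
       {surface_relator orient k m} \<and>
     (\<forall>w \<in> nbrs T v. \<exists>i < m. \<exists>q \<in> vstab G T v. estab G T v w \<subseteq> boundary_subgroup G f i q) \<and>
     (\<forall>i < m. \<exists>w \<in> nbrs T v. \<exists>q \<in> vstab G T v. estab G T v w \<subseteq> boundary_subgroup G f i q)"

definition surface_vertex :: "('g, 'm) monoid_scheme \<Rightarrow> ('g, 'v) gtree \<Rightarrow> 'v \<Rightarrow> bool" where
  "surface_vertex G T v \<longleftrightarrow> v \<in> tverts T \<and> (\<exists>orient k m f. surface_structure G T v orient k m f)"

definition abelian_vertex :: "('g, 'm) monoid_scheme \<Rightarrow> ('g, 'v) gtree \<Rightarrow> 'v \<Rightarrow> bool" where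
  "abelian_vertex G T v \<longleftrightarrow> v \<in> tverts T \<and> abelian_in G (vstab G T v)"

text \<open>Test trees have vertices in \<open>nat\<close>: a minimal tree for a finitely generated group has
  countably many vertices, so up to isomorphism all splittings are covered.\<close>

definition universally_elliptic :: "('g, 'm) monoid_scheme \<Rightarrow> 'g set \<Rightarrow> bool" where
  "universally_elliptic G H \<longleftrightarrow> (\<forall>T :: ('g, nat) gtree. cyclic_splitting G T \<longrightarrow> elliptic G T H)"

definition rigid_vertex :: "('g, 'm) monoid_scheme \<Rightarrow> ('g, 'v) gtree \<Rightarrow> 'v \<Rightarrow> bool" where
  "rigid_vertex G T v \<longleftrightarrow>
     v \<in> tverts T \<and> \<not> abelian_vertex G T v \<and> \<not> surface_vertex G T v \<and>
     universally_elliptic G (vstab G T v)"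


section \<open>The cyclic JSJ decomposition of Rips and Sela\<close>

text \<open>Splittings obtained from \<open>T\<close> by cutting surface vertex groups along disjoint simple closed
  curves: refinements of \<open>T\<close> by cyclic edge groups that blow up surface vertices only. Such a
  blow-up is a cyclic splitting of the surface group relative to its boundary, hence dual to
  simple closed curves.\<close>

definition surface_refinement ::
  "('g, 'm) monoid_scheme \<Rightarrow> ('g, 'v) gtree \<Rightarrow> ('g, 'w) gtree \<Rightarrow> ('w \<Rightarrow> 'v) \<Rightarrow> bool" where
  "surface_refinement G T T' p \<longleftrightarrow>
     cyclic_splitting G T' \<and> collapse_map G T' T p \<and>
     (\<forall>(x, y) \<in> tedges T'. p x = p y \<longrightarrow> surface_vertex G T (p x))"

text \<open>The clauses after the trichotomy of vertex groups are the defining properties (i)-(iv) in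
  the theorem of Rips and Sela; (i) consists of the first two of them. In (ii), each edge of the refinement is either an edge of \<open>T\<close>
  (collapsed by \<open>q\<close>) or dual to the cutting curve (collapsed by \<open>p\<close>).\<close>

definition cyclic_JSJ :: "('g, 'm) monoid_scheme \<Rightarrow> ('g, 'v) gtree \<Rightarrow> bool" where
  "cyclic_JSJ G T \<longleftrightarrow>
     cyclic_splitting G T \<and> reduced_splitting G T \<and>
     (\<forall>v \<in> tverts T. surface_vertex G T v \<or> abelian_vertex G T v \<or> rigid_vertex G T v) \<and>
     (\<forall>v \<in> tverts T. \<not> surface_vertex G T v \<longrightarrow> universally_elliptic G (vstab G T v)) \<and>
     (\<forall>(T' :: ('g, nat) gtree) u. cyclic_splitting G T' \<and> surface_vertex G T' u \<longrightarrow>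
        (\<exists>v. surface_vertex G T v \<and> vstab G T' u \<subseteq> vstab G T v)) \<and>
     (\<forall>(T1 :: ('g, nat) gtree) (T2 :: ('g, nat) gtree).
        elementary_splitting G T1 \<and> elementary_splitting G T2 \<and> hyperbolic_in G T1 T2 \<longrightarrow>
        (\<exists>(T' :: ('g, nat) gtree) p q. surface_refinement G T T' p \<and> collapse_map G T' T1 q \<and>
           (\<forall>(x, y) \<in> tedges T'. p x = p y \<longleftrightarrow> q x \<noteq> q y))) \<and>
     (\<forall>T1 :: ('g, nat) gtree.
        elementary_splitting G T1 \<and>
        (\<forall>T2 :: ('g, nat) gtree. elementary_splitting G T2 \<longrightarrow> \<not> hyperbolic_in G T1 T2) \<longrightarrow>
        dominates G T T1) \<and>
     (\<forall>T1 :: ('g, nat) gtree. cyclic_splitting G T1 \<longrightarrow>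
        (\<exists>(T' :: ('g, nat) gtree) p. surface_refinement G T T' p \<and> dominates G T' T1))"


section \<open>The modular group\<close>

definition inner_auts :: "('g, 'm) monoid_scheme \<Rightarrow> ('g \<Rightarrow> 'g) set" where
  "inner_auts G = {restrict (conj_elt G c) (carrier G) | c. c \<in> carrier G}"

definition edge_side ::
  "('g, 'm) monoid_scheme \<Rightarrow> ('g, 'v) gtree \<Rightarrow> 'v \<Rightarrow> 'v \<Rightarrow> 'v \<Rightarrow> 'v set" where
  "edge_side G T v w x = {y \<in> tverts T. (x, y) \<in> (tedges T - edge_orbit G T v w)\<^sup>*}"

text \<open>Collapsing all edges outside the orbit of \<open>(v, w)\<close> gives a splitting \<open>A *\<^sub>C B\<close>, or an HNN
  extension of \<open>A\<close> with stable letter \<open>t\<close>, where \<open>A\<close> and \<open>B\<close> are the stabilisers of the sides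
  \<open>U\<close> and \<open>W\<close>. The Dehn twist by \<open>c\<close> in the edge group is the identity on \<open>A\<close> and is conjugation
  by \<open>c\<close> on \<open>B\<close>, respectively sends \<open>t\<close> to \<open>ct\<close>.\<close>

definition dehn_twists :: "('g, 'm) monoid_scheme \<Rightarrow> ('g, 'v) gtree \<Rightarrow> ('g \<Rightarrow> 'g) set" where
  "dehn_twists G T = {\<phi> \<in> auto G. \<exists>(v, w) \<in> tedges T. \<exists>c \<in> estab G T v w.
     let U = edge_side G T v w v; W = edge_side G T v w w;
         stable_letters = {t \<in> carrier G. tact T t ` U = W}
     in (\<forall>a \<in> setstab G T U. \<phi> a = a) \<and>
        (\<forall>t \<in> stable_letters. \<phi> t = c \<otimes>\<^bsub>G\<^esub> t) \<and>
        (stable_letters = {} \<longrightarrow> (\<forall>b \<in> setstab G T W. \<phi> b = conj_elt G c b))}"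

text \<open>The closure of the component of \<open>T\<close> minus the orbit of \<open>v\<close> in the direction of the
  neighbour \<open>w\<close> of \<open>v\<close>.\<close>

inductive_set block :: "('g, 'm) monoid_scheme \<Rightarrow> ('g, 'v) gtree \<Rightarrow> 'v \<Rightarrow> 'v \<Rightarrow> 'v set"
  for G T v w where
  base: "v \<in> block G T v w"
| start: "w \<in> block G T v w"
| step: "x \<in> block G T v w \<Longrightarrow> x \<notin> orbit G (tact T) v \<Longrightarrow> (x, y) \<in> tedges T \<Longrightarrow> y \<in> block G T v w"

text \<open>\<open>\<phi>\<close> is the extension to \<open>G\<close> of an automorphism of the vertex group of \<open>v\<close> that is
  conjugation by elements of \<open>\<Gamma>\<close> on the incident edge groups: there is a \<open>\<phi>\<close>-equivariant
  automorphism \<open>h\<close> of \<open>T\<close> fixing \<open>v\<close> such that, on each block at \<open>v\<close>, \<open>h\<close> is translation by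
  some \<open>\<gamma>\<close> in \<open>\<Gamma>\<close> and \<open>\<phi>\<close> is conjugation by the same \<open>\<gamma>\<close>.\<close>

definition extends_vertex_aut ::
  "('g, 'm) monoid_scheme \<Rightarrow> ('g, 'v) gtree \<Rightarrow> 'v \<Rightarrow> 'g set \<Rightarrow> ('g \<Rightarrow> 'g) \<Rightarrow> bool" where
  "extends_vertex_aut G T v \<Gamma> \<phi> \<longleftrightarrow>
     \<phi> \<in> auto G \<and> \<phi> ` vstab G T v = vstab G T v \<and>
     (\<exists>h. bij_betw h (tverts T) (tverts T) \<and>
        (\<forall>x \<in> tverts T. \<forall>y \<in> tverts T. (x, y) \<in> tedges T \<longleftrightarrow> (h x, h y) \<in> tedges T) \<and>
        (\<forall>g \<in> carrier G. \<forall>x \<in> tverts T. h (tact T g x) = tact T (\<phi> g) (h x)) \<and>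
        h v = v \<and>
        (\<forall>w \<in> nbrs T v. \<exists>\<gamma> \<in> \<Gamma>.
           (\<forall>x \<in> block G T v w. h x = tact T \<gamma> x) \<and>
           (\<forall>s \<in> setstab G T (block G T v w). \<phi> s = conj_elt G \<gamma> s)))"

definition surface_auts :: "('g, 'm) monoid_scheme \<Rightarrow> ('g, 'v) gtree \<Rightarrow> ('g \<Rightarrow> 'g) set" where
  "surface_auts G T = {\<phi>. \<exists>v \<in> tverts T. extends_vertex_aut G T v (vstab G T v) \<phi> \<and>
     (\<exists>orient k m f. surface_structure G T v orient k m f \<and>
        (\<forall>i < m. \<exists>q \<in> vstab G T v. \<phi> (f (Bdry i)) = conj_elt G q (f (Bdry i))))}"

definition abelian_auts :: "('g, 'm) monoid_scheme \<Rightarrow> ('g, 'v) gtree \<Rightarrow> ('g \<Rightarrow> 'g) set" where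
  "abelian_auts G T = {\<phi>. \<exists>v. abelian_vertex G T v \<and> extends_vertex_aut G T v {\<one>\<^bsub>G\<^esub>} \<phi> \<and>
     (\<forall>w \<in> nbrs T v. \<forall>x \<in> estab G T v w. \<phi> x = x)}"

definition modular_group :: "('g, 'm) monoid_scheme \<Rightarrow> ('g, 'v) gtree \<Rightarrow> ('g \<Rightarrow> 'g) set" where
  "modular_group G T = generate (AutoGroup G)
     (inner_auts G \<union> dehn_twists G T \<union> surface_auts G T \<union> abelian_auts G T)"


section \<open>Limit groups and shortening quotients\<close>

definition stable_sequence ::
  "('g, 'm) monoid_scheme \<Rightarrow> ('f, 'n) monoid_scheme \<Rightarrow> (nat \<Rightarrow> 'g \<Rightarrow> 'f) \<Rightarrow> bool" where
  "stable_sequence G F h \<longleftrightarrow>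
     (\<forall>n. h n \<in> hom G F) \<and>
     (\<forall>g \<in> carrier G. (\<forall>\<^sub>F n in sequentially. h n g = \<one>\<^bsub>F\<^esub>) \<or>
                       (\<forall>\<^sub>F n in sequentially. h n g \<noteq> \<one>\<^bsub>F\<^esub>))"

definition stable_kernel ::
  "('g, 'm) monoid_scheme \<Rightarrow> ('f, 'n) monoid_scheme \<Rightarrow> (nat \<Rightarrow> 'g \<Rightarrow> 'f) \<Rightarrow> 'g set" where
  "stable_kernel G F h = {g \<in> carrier G. \<forall>\<^sub>F n in sequentially. h n g = \<one>\<^bsub>F\<^esub>}"

text \<open>Finitely generated groups are countable, so it suffices to let \<open>G\<close> have its elements in
  \<open>nat\<close>.\<close>

definition limit_group :: "('f, 'n) monoid_scheme \<Rightarrow> ('g, 'm) monoid_scheme \<Rightarrow> bool" where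
  "limit_group F L \<longleftrightarrow> group L \<and>
     (\<exists>(G :: nat monoid) S h \<pi>. group G \<and> finite_generating_set G S \<and> stable_sequence G F h \<and>
        \<pi> \<in> epi G L \<and> kernel G L \<pi> = stable_kernel G F h)"

definition shortest_hom ::
  "('f, 'n) monoid_scheme \<Rightarrow> 'f set \<Rightarrow> ('g, 'm) monoid_scheme \<Rightarrow> ('g, 'v) gtree \<Rightarrow> 'g set \<Rightarrow>
   ('g \<Rightarrow> 'f) \<Rightarrow> bool" where
  "shortest_hom F Y G T S h \<longleftrightarrow>
     h \<in> hom G F \<and>
     (\<forall>c \<in> carrier F. \<forall>\<phi> \<in> modular_group G T.
        Max ((\<lambda>s. word_length F Y (h s)) ` S)
          \<le> Max ((\<lambda>s. word_length F Y (conj_elt F c (h (\<phi> s)))) ` S))"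

definition shortening_quotient ::
  "('f, 'n) monoid_scheme \<Rightarrow> 'f set \<Rightarrow> ('g, 'm) monoid_scheme \<Rightarrow> ('g, 'v) gtree \<Rightarrow> 'g set \<Rightarrow>
   ('q, 'k) monoid_scheme \<Rightarrow> ('g \<Rightarrow> 'q) \<Rightarrow> bool" where
  "shortening_quotient F Y G T S Q \<eta> \<longleftrightarrow>
     group Q \<and> \<eta> \<in> epi G Q \<and>
     (\<exists>h. stable_sequence G F h \<and> (\<forall>n. shortest_hom F Y G T S (h n)) \<and>
          kernel G Q \<eta> = stable_kernel G F h)"

definition quotient_le ::
  "('g, 'm) monoid_scheme \<Rightarrow> ('q, 'k) monoid_scheme \<Rightarrow> ('g \<Rightarrow> 'q) \<Rightarrow>
   ('r, 'l) monoid_scheme \<Rightarrow> ('g \<Rightarrow> 'r) \<Rightarrow> bool" where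
  "quotient_le G Q \<eta> M \<pi> \<longleftrightarrow> (\<exists>\<sigma> \<in> epi M Q. \<forall>x \<in> carrier G. \<eta> x = \<sigma> (\<pi> x))"

text \<open>Every quotient of \<open>G\<close> is isomorphic to a group of cosets, so \<open>M\<close> may range over groups with
  elements in \<open>'g set\<close>.\<close>

definition maximal_shortening_quotient ::
  "('f, 'n) monoid_scheme \<Rightarrow> 'f set \<Rightarrow> ('g, 'm) monoid_scheme \<Rightarrow> ('g, 'v) gtree \<Rightarrow> 'g set \<Rightarrow>
   ('q, 'k) monoid_scheme \<Rightarrow> ('g \<Rightarrow> 'q) \<Rightarrow> bool" where
  "maximal_shortening_quotient F Y G T S Q \<eta> \<longleftrightarrow>
     shortening_quotient F Y G T S Q \<eta> \<and>
     (\<forall>(M :: 'g set monoid) \<pi>. shortening_quotient F Y G T S M \<pi> \<and> quotient_le G Q \<eta> M \<pi> \<longrightarrow>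
        quotient_le G M \<pi> Q \<eta>)"

definition SQ_isomorphic ::
  "('g, 'm) monoid_scheme \<Rightarrow> ('g, 'v) gtree \<Rightarrow> ('r, 'l) monoid_scheme \<Rightarrow> ('g \<Rightarrow> 'r) \<Rightarrow>
   ('q, 'k) monoid_scheme \<Rightarrow> ('g \<Rightarrow> 'q) \<Rightarrow> bool" where
  "SQ_isomorphic G T M \<pi> Q \<eta> \<longleftrightarrow>
     (\<exists>\<sigma> \<in> iso M Q. \<exists>\<phi> \<in> modular_group G T. \<forall>x \<in> carrier G. \<eta> (\<phi> x) = \<sigma> (\<pi> x))"


section \<open>Strict quotients\<close>

definition incident_span :: "('g, 'm) monoid_scheme \<Rightarrow> ('g, 'v) gtree \<Rightarrow> 'v \<Rightarrow> 'g set" where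
  "incident_span G T v = generate G (\<Union>w \<in> nbrs T v. estab G T v w)"

text \<open>The vertex groups after every abelian vertex group neighbouring that of \<open>v\<close> in the quotient
  graph is replaced by the smallest direct summand containing its edge groups.\<close>

definition trimmed_vstab :: "('g, 'm) monoid_scheme \<Rightarrow> ('g, 'v) gtree \<Rightarrow> 'v \<Rightarrow> 'v \<Rightarrow> 'g set" where
  "trimmed_vstab G T v x =
     (if abelian_vertex G T x \<and> (\<exists>g \<in> carrier G. x \<in> nbrs T (tact T g v))
      then \<Inter> {D. direct_summand G D (vstab G T x) \<and> incident_span G T x \<subseteq> D}
      else vstab G T x)"

text \<open>The fundamental group of the new graph of groups, realised as a subgroup \<open>K\<close> of \<open>G\<close>
  together with a \<open>K\<close>-invariant subtree with vertex set \<open>W\<close> through \<open>v\<close>: the inclusion induces an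
  isomorphism of quotient graphs, and vertex stabilisers in \<open>K\<close> are the new vertex groups.\<close>

definition trimmed_subgroup ::
  "('g, 'm) monoid_scheme \<Rightarrow> ('g, 'v) gtree \<Rightarrow> 'v \<Rightarrow> 'g set \<Rightarrow> 'v set \<Rightarrow> bool" where
  "trimmed_subgroup G T v K W \<longleftrightarrow>
     subgroup K G \<and> v \<in> W \<and> W \<subseteq> tverts T \<and> induced_connected T W \<and>
     (\<forall>g \<in> K. tact T g ` W = W) \<and>
     (\<forall>x \<in> tverts T. \<exists>g \<in> carrier G. tact T g x \<in> W) \<and>
     (\<forall>(x, y) \<in> tedges T. \<exists>g \<in> carrier G. tact T g x \<in> W \<and> tact T g y \<in> W) \<and>
     (\<forall>x \<in> W. \<forall>g \<in> carrier G. tact T g x \<in> W \<longrightarrow> (\<exists>k \<in> K. tact T k x = tact T g x)) \<and>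
     (\<forall>(x, y) \<in> tedges T \<inter> W \<times> W. \<forall>g \<in> carrier G. tact T g x \<in> W \<and> tact T g y \<in> W \<longrightarrow>
        (\<exists>k \<in> K. tact T k x = tact T g x \<and> tact T k y = tact T g y)) \<and>
     (\<forall>x \<in> W. K \<inter> vstab G T x = trimmed_vstab G T v x)"

definition rigid_envelope :: "('g, 'm) monoid_scheme \<Rightarrow> ('g, 'v) gtree \<Rightarrow> 'v \<Rightarrow> 'g set \<Rightarrow> 'g set" where
  "rigid_envelope G T v K =
     generate G (vstab G T v \<union>
       (\<Union>w \<in> nbrs T v. {x \<in> K. \<forall>c \<in> estab G T v w. x \<otimes>\<^bsub>G\<^esub> c = c \<otimes>\<^bsub>G\<^esub> x}))"

definition strict_quotient ::
  "('g, 'm) monoid_scheme \<Rightarrow> ('g, 'v) gtree \<Rightarrow> ('q, 'k) monoid_scheme \<Rightarrow> ('g \<Rightarrow> 'q) \<Rightarrow> bool" where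
  "strict_quotient G T Q \<eta> \<longleftrightarrow>
     (\<forall>v. rigid_vertex G T v \<longrightarrow>
        (\<forall>K W. trimmed_subgroup G T v K W \<longrightarrow> inj_on \<eta> (rigid_envelope G T v K))) \<and>
     (\<forall>v orient k m f. v \<in> tverts T \<and> surface_structure G T v orient k m f \<longrightarrow>
        \<not> abelian_in Q (\<eta> ` vstab G T v) \<and>
        (\<forall>i < m. \<forall>q \<in> vstab G T v. \<forall>x \<in> boundary_subgroup G f i q.
           x \<noteq> \<one>\<^bsub>G\<^esub> \<longrightarrow> \<eta> x \<noteq> \<one>\<^bsub>Q\<^esub>)) \<and>
     (\<forall>v. abelian_vertex G T v \<longrightarrow> inj_on \<eta> (incident_span G T v))"

end

theory Submission
  imports Defs "HOL-Library.Countable_Set"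
begin

text \<open>
  A shortening quotient may be witnessed by a constant sequence, and this makes the statement
  follow from a single homomorphism. The group \<open>Q\<close> is a quotient of \<open>L\<close> by a stable kernel and is
  not abelian, so \<open>F\<close> cannot be abelian either and has two distinct basis elements \<open>a\<close> and \<open>b\<close>
  (lemmas \<open>stable_quotient_commutes\<close> and \<open>free_basis_obtain_two\<close>). Hence the free group \<open>Q\<close> embeds in
  \<open>F\<close> (\<open>free_group_embedding\<close>); composing \<open>\<eta>\<close> with an embedding gives \<open>h : L \<rightarrow> F\<close> with the kernel
  of \<open>\<eta>\<close>.

  Fix a finite generating set \<open>U\<close>. The lengths of the maps \<open>\<iota>\<^sub>c \<circ> h \<circ> \<phi>\<close>, for \<open>c\<close> in \<open>F\<close> and \<open>\<phi>\<close> in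
  the modular group, are natural numbers, so one of these maps has minimal length; because the
  modular group and the inner automorphisms of \<open>F\<close> are closed under composition, this map is
  \<open>U\<close>-shortest (\<open>shortest_hom_exists\<close>). Conjugation and the embedding are injective, so its
  kernel is that of \<open>\<eta> \<circ> \<phi>\<close>. The constant sequence therefore shows that \<open>L\<close> modulo this kernel is
  a \<open>U\<close>-shortening quotient, and \<open>\<phi>\<close> itself is the modular automorphism that an SQ-isomorphism
  with \<open>(Q, \<eta>)\<close> requires.
\<close>

section \<open>Values of words\<close>

definition inverse_word :: "'x word \<Rightarrow> 'x word" where
  "inverse_word w = rev (map (\<lambda>(x, s). (x, \<not> s)) w)"

lemma words_over_append [simp]: "u @ v \<in> words_over X \<longleftrightarrow> u \<in> words_over X \<and> v \<in> words_over X"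
  by (auto simp: words_over_def)

lemma words_over_Cons [simp]: "p # v \<in> words_over X \<longleftrightarrow> fst p \<in> X \<and> v \<in> words_over X"
  by (auto simp: words_over_def)

lemma words_over_Nil [simp]: "[] \<in> words_over X"
  by (auto simp: words_over_def)

lemma inverse_word_over [simp]: "inverse_word w \<in> words_over X \<longleftrightarrow> w \<in> words_over X"
  by (simp add: inverse_word_def words_over_def image_image case_prod_beta)

lemma word_val_Nil [simp]: "word_val G f [] = \<one>\<^bsub>G\<^esub>"
  by (simp add: word_val_def)

lemma word_val_Cons [simp]:
  "word_val G f ((x, s) # w) = (if s then f x else inv\<^bsub>G\<^esub> (f x)) \<otimes>\<^bsub>G\<^esub> word_val G f w"
  by (simp add: word_val_def)

context group
begin

lemma inv_mult_cancel [simp]: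
  assumes "c \<in> carrier G" "x \<in> carrier G"
  shows "inv c \<otimes> (c \<otimes> x) = x" "c \<otimes> (inv c \<otimes> x) = x"
  using assms by (simp_all add: m_assoc[symmetric])

lemma mult_inv_eq_one_iff:
  assumes "x \<in> carrier G" "y \<in> carrier G"
  shows "x \<otimes> inv y = \<one> \<longleftrightarrow> x = y"
  using inv_solve_right[of "\<one>" x y] assms by auto

lemma word_val_closed:
  assumes "w \<in> words_over X" "f ` X \<subseteq> carrier G"
  shows "word_val G f w \<in> carrier G"
  using assms by (induction w) auto

lemma word_val_append:
  assumes "u \<in> words_over X" "v \<in> words_over X" "f ` X \<subseteq> carrier G"
  shows "word_val G f (u @ v) = word_val G f u \<otimes> word_val G f v"
  using assms
proof (induction u)
  case Nil
  then show ?case using word_val_closed[of v X f] by simp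
next
  case (Cons p u)
  then show ?case
    using word_val_closed[of u X f] word_val_closed[of v X f]
    by (cases p) (auto simp: m_assoc image_subset_iff)
qed

lemma word_val_inverse:
  assumes "w \<in> words_over X" "f ` X \<subseteq> carrier G"
  shows "word_val G f (inverse_word w) = inv (word_val G f w)"
  using assms
proof (induction w)
  case Nil
  then show ?case by (simp add: inverse_word_def)
next
  case (Cons p w)
  obtain x s where p: "p = (x, s)" by fastforce
  have x: "x \<in> X" "f x \<in> carrier G" "w \<in> words_over X" using Cons.prems p by auto
  have "word_val G f (inverse_word (p # w)) = word_val G f (inverse_word w @ [(x, \<not> s)])"
    by (simp add: inverse_word_def p)
  also have "\<dots> = inv (word_val G f w) \<otimes> word_val G f [(x, \<not> s)]"
    using word_val_append[of "inverse_word w" X "[(x, \<not> s)]" f] Cons x by simp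
  also have "\<dots> = inv (word_val G f (p # w))"
    using word_val_closed[OF x(3) Cons.prems(2)] x p by (simp add: inv_mult_group)
  finally show ?case .
qed

lemma word_val_eq_iff:
  assumes "u \<in> words_over X" "v \<in> words_over X" "f ` X \<subseteq> carrier G"
  shows "word_val G f u = word_val G f v \<longleftrightarrow> word_val G f (u @ inverse_word v) = \<one>"
  using assms by (simp add: word_val_append word_val_inverse word_val_closed mult_inv_eq_one_iff)

lemma generate_obtain_word:
  assumes "q \<in> generate G (f ` X)" "f ` X \<subseteq> carrier G"
  obtains w where "w \<in> words_over X" "word_val G f w = q"
proof -
  have "\<exists>w \<in> words_over X. word_val G f w = q"
    using assms(1)
  proof induction
    case one
    then show ?case by (auto intro!: bexI[of _ "[]"])
  next
    case (incl h)
    then obtain x where "x \<in> X" "h = f x" by auto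
    then show ?case using assms(2) by (auto intro!: bexI[of _ "[(x, True)]"])
  next
    case (inv h)
    then obtain x where "x \<in> X" "h = f x" by auto
    then show ?case using assms(2) by (auto intro!: bexI[of _ "[(x, False)]"])
  next
    case (eng h1 h2)
    then obtain u v where "u \<in> words_over X" "word_val G f u = h1"
      "v \<in> words_over X" "word_val G f v = h2" by auto
    then show ?case using word_val_append[OF _ _ assms(2)] by (auto intro!: bexI[of _ "u @ v"])
  qed
  then show ?thesis using that by blast
qed

text \<open>Every image of the letters is required to lie in the group, because a derivation of
  triviality may pass through words over arbitrary letters.\<close>

lemma word_val_trivial_word:
  fixes f :: "'x \<Rightarrow> 'a"
  assumes "w \<in> trivial_words {}" "range f \<subseteq> carrier G"
  shows "word_val G f w = \<one>"
proof -
  have UNIV: "v \<in> words_over UNIV" for v :: "'x word" by (simp add: words_over_def)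
  note app = word_val_append[OF UNIV UNIV assms(2)]
  have pair: "word_val G f (u @ [(x, s), (x, \<not> s)] @ v) = word_val G f (u @ v)" for u x s v
  proof -
    have "word_val G f [(x, s), (x, \<not> s)] = \<one>"
    proof -
      have "f x \<in> carrier G" using assms(2) by blast
      then show ?thesis by simp
    qed
    then show ?thesis
      by (simp only: app) (simp add: word_val_closed[OF UNIV assms(2)])
  qed
  show ?thesis
    using assms(1)
  proof induction
    case (ins_pair u v x s)
    then show ?case using pair by metis
  next
    case (del_pair u x s v)
    then show ?case using pair by metis
  qed auto
qed

end

text \<open>Words \<open>u\<close> and \<open>v\<close> have the same value exactly if \<open>u v\<^sup>-\<^sup>1\<close> is trivial, so a map on generators for which the
  same words become trivial is well defined, and injective, on group elements.\<close>

lemma presentation_embedding: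
  assumes G: "has_presentation G X f R" and H: "group H" "g ` X \<subseteq> carrier H"
    and triv: "\<And>w. w \<in> words_over X \<Longrightarrow> word_val H g w = \<one>\<^bsub>H\<^esub> \<longleftrightarrow> w \<in> trivial_words R"
  obtains h where "h \<in> hom G H" "inj_on h (carrier G)"
proof -
  interpret G: group G using G by (simp add: has_presentation_def)
  interpret H: group H by (rule H(1))
  have f: "f ` X \<subseteq> carrier G" and gen: "generate G (f ` X) = carrier G"
    and Gtriv: "\<And>w. w \<in> words_over X \<Longrightarrow> word_val G f w = \<one>\<^bsub>G\<^esub> \<longleftrightarrow> w \<in> trivial_words R"
    using G by (auto simp: has_presentation_def)
  have eq: "word_val G f u = word_val G f v \<longleftrightarrow> word_val H g u = word_val H g v"
    if "u \<in> words_over X" "v \<in> words_over X" for u v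
    using that f H(2) by (simp add: G.word_val_eq_iff H.word_val_eq_iff Gtriv triv)
  have "\<forall>q \<in> carrier G. \<exists>w \<in> words_over X. word_val G f w = q"
    using G.generate_obtain_word f gen by metis
  then obtain rep where rep: "\<And>q. q \<in> carrier G \<Longrightarrow> rep q \<in> words_over X \<and> word_val G f (rep q) = q"
    by metis
  define h where "h q = word_val H g (rep q)" for q
  have "h \<in> hom G H"
  proof (rule homI)
    fix x y assume xy: "x \<in> carrier G" "y \<in> carrier G"
    have "word_val G f (rep (x \<otimes>\<^bsub>G\<^esub> y)) = word_val G f (rep x @ rep y)"
      using xy rep[of x] rep[of y] rep[of "x \<otimes>\<^bsub>G\<^esub> y"] G.word_val_append[of "rep x" X "rep y" f] f
      by simp
    then have "word_val H g (rep (x \<otimes>\<^bsub>G\<^esub> y)) = word_val H g (rep x @ rep y)"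
      using xy rep by (subst (asm) eq) simp_all
    then show "h (x \<otimes>\<^bsub>G\<^esub> y) = h x \<otimes>\<^bsub>H\<^esub> h y"
      unfolding h_def
      using xy rep[of x] rep[of y] H.word_val_append[of "rep x" X "rep y" g] H(2) by simp
  next
    fix x assume "x \<in> carrier G"
    then show "h x \<in> carrier H" unfolding h_def using rep H.word_val_closed H(2) by metis
  qed
  moreover have "inj_on h (carrier G)"
  proof (rule inj_onI)
    fix x y assume "x \<in> carrier G" "y \<in> carrier G" "h x = h y"
    then show "x = y" using rep eq[of "rep x" "rep y"] by (simp add: h_def)
  qed
  ultimately show ?thesis using that by blast
qed


section \<open>Embedding free groups in non-abelian free groups\<close>

definition exponent_sum :: "'x \<Rightarrow> 'x word \<Rightarrow> int" where
  "exponent_sum y w = (\<Sum>(x, s)\<leftarrow>w. if x = y then if s then 1 else -1 else 0)"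

lemma exponent_sum_simps [simp]:
  "exponent_sum y [] = 0"
  "exponent_sum y ((x, s) # w) = (if x = y then if s then 1 else -1 else 0) + exponent_sum y w"
  "exponent_sum y (u @ v) = exponent_sum y u + exponent_sum y v"
  by (auto simp: exponent_sum_def)

lemma exponent_sum_trivial_word:
  "w \<in> trivial_words {} \<Longrightarrow> exponent_sum y w = 0"
  by (induction rule: trivial_words.induct) (auto split: if_splits)

text \<open>In the infinite cyclic cover of a rose in which the loop \<open>a\<close> unwinds to a line, the lifts of
  the loop \<open>b\<close> become free generators once the line is collapsed, one at each height \<open>k\<close>. The
  function follows the lift of \<open>w\<close> starting at height \<open>k\<close> and records the lifts of \<open>b\<close> that it
  crosses, writing \<open>e j\<close> for the one at height \<open>j\<close>; all other loops are collapsed.\<close>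

fun read_lift :: "'y \<Rightarrow> 'y \<Rightarrow> (int \<Rightarrow> 'x) \<Rightarrow> int \<Rightarrow> 'y word \<Rightarrow> 'x word" where
  "read_lift a b e k [] = []"
| "read_lift a b e k ((y, s) # w) =
     (if y = a then read_lift a b e (if s then k + 1 else k - 1) w
      else if y = b then (e k, s) # read_lift a b e k w
      else read_lift a b e k w)"

lemma read_lift_append:
  "read_lift a b e k (u @ v) = read_lift a b e k u @ read_lift a b e (k + exponent_sum a u) v"
  by (induction a b e k u rule: read_lift.induct) (auto simp: algebra_simps)

text \<open>A cancelling pair lifts to a path that returns to its height and records nothing or a
  cancelling pair.\<close>

lemma read_lift_trivial_word:
  "w \<in> trivial_words {} \<Longrightarrow> read_lift a b e k w \<in> trivial_words {}"
proof (induction rule: trivial_words.induct)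
  case empty
  then show ?case by (simp add: trivial_words.empty)
next
  case (ins_pair u v x s)
  then show ?case
    using trivial_words.ins_pair[of "read_lift a b e k u" _ "{}" _ s]
    by (auto simp: read_lift_append)
next
  case (del_pair u x s v)
  show ?case
  proof (cases "x = b \<and> x \<noteq> a")
    case True
    then have "read_lift a b e k u @
        [(e (k + exponent_sum a u), s), (e (k + exponent_sum a u), \<not> s)] @
        read_lift a b e (k + exponent_sum a u) v \<in> trivial_words {}"
      using True del_pair.IH by (simp add: read_lift_append)
    then show ?thesis unfolding read_lift_append by (rule trivial_words.del_pair)
  next
    case False
    then show ?thesis using del_pair.IH by (auto simp: read_lift_append split: if_splits)
  qed
qed auto

definition conj_word :: "'y \<Rightarrow> 'y \<Rightarrow> nat \<Rightarrow> bool \<Rightarrow> 'y word" where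
  "conj_word a b i s = replicate i (a, True) @ [(b, s)] @ replicate i (a, False)"

lemma exponent_sum_replicate [simp]:
  "exponent_sum a (replicate i (a, s)) = (if s then int i else - int i)"
  by (induction i) auto

lemma read_lift_replicate [simp]: "read_lift a b e k (replicate i (a, s)) = []"
  by (induction i arbitrary: k) auto

lemma read_lift_conj_word:
  assumes "a \<noteq> b"
  shows "read_lift a b e 0 (conj_word a b i s @ v) = (e (int i), s) # read_lift a b e 0 v"
  using assms by (simp add: conj_word_def read_lift_append)

lemma read_lift_substitution:
  assumes "a \<noteq> b" "w \<in> words_over X" "\<And>x. x \<in> X \<Longrightarrow> e (int (i x)) = x"
  shows "read_lift a b e 0 (concat (map (\<lambda>(x, s). conj_word a b (i x) s) w)) = w"
  using assms(2) by (induction w) (auto simp: read_lift_conj_word assms(1,3))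

lemma inverse_word_conj_word: "inverse_word (conj_word a b i s) = conj_word a b i (\<not> s)"
  by (simp add: conj_word_def inverse_word_def)

text \<open>The elements \<open>a\<^sup>i b a\<^sup>-\<^sup>i\<close> freely generate a subgroup. If a word in them is trivial in \<open>G\<close>, then
  so is the word that its lift records, and this is the word itself.\<close>

lemma free_group_embedding:
  assumes H: "free_basis H X" and X: "countable X"
    and G: "free_basis G Y" and ab: "a \<in> Y" "b \<in> Y" "a \<noteq> b"
  obtains f where "f \<in> hom H G" "inj_on f (carrier H)"
proof -
  have "has_presentation G Y (\<lambda>x. x) {}" using G by (simp add: free_basis_def)
  then have grp: "group G" and Y: "Y \<subseteq> carrier G"
    and triv: "\<And>w. w \<in> words_over Y \<Longrightarrow> word_val G (\<lambda>x. x) w = \<one>\<^bsub>G\<^esub> \<longleftrightarrow> w \<in> trivial_words {}"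
    by (auto simp: has_presentation_def)
  interpret G: group G by (rule grp)
  define i where "i = to_nat_on X"
  define e where "e k = from_nat_into X (nat k)" for k
  have e: "e (int (i x)) = x" if "x \<in> X" for x
    using that X by (simp add: e_def i_def)
  define g where "g x = word_val G (\<lambda>y. y) (conj_word a b (i x) True)" for x
  have over: "conj_word a b j s \<in> words_over Y" for j s
    using ab by (auto simp: conj_word_def words_over_def)
  have g: "range g \<subseteq> carrier G"
    using G.word_val_closed[OF over] Y by (auto simp: g_def)
  have letter: "(if s then g x else inv\<^bsub>G\<^esub> (g x)) = word_val G (\<lambda>y. y) (conj_word a b (i x) s)" for x s
    using G.word_val_inverse[OF over, of "\<lambda>y. y" "i x" True] Y
    by (simp add: g_def inverse_word_conj_word)
  define subst where "subst w = concat (map (\<lambda>(x, s). conj_word a b (i x) s) w)" for w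
  have subst_over: "subst w \<in> words_over Y" for w
    by (induction w) (auto simp: subst_def over)
  have val: "word_val G g w = word_val G (\<lambda>y. y) (subst w)" for w
  proof (induction w)
    case Nil
    then show ?case by (simp add: subst_def)
  next
    case (Cons p w)
    obtain x s where p: "p = (x, s)" by fastforce
    have "word_val G (\<lambda>y. y) (subst (p # w)) = word_val G (\<lambda>y. y) (conj_word a b (i x) s @ subst w)"
      by (simp add: subst_def p)
    also have "\<dots> = word_val G g (p # w)"
      using G.word_val_append[OF over subst_over, of "\<lambda>y. y"] Y Cons
      by (simp only: p word_val_Cons letter) simp
    finally show ?case by simp
  qed
  have "word_val G g w = \<one>\<^bsub>G\<^esub> \<longleftrightarrow> w \<in> trivial_words {}" if w: "w \<in> words_over X" for w
  proof
    assume "word_val G g w = \<one>\<^bsub>G\<^esub>"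
    then have "subst w \<in> trivial_words {}" using val triv subst_over by simp
    then have "read_lift a b e 0 (subst w) \<in> trivial_words {}" by (rule read_lift_trivial_word)
    then show "w \<in> trivial_words {}"
      using read_lift_substitution[OF ab(3) w e] by (simp add: subst_def)
  next
    assume "w \<in> trivial_words {}"
    then show "word_val G g w = \<one>\<^bsub>G\<^esub>" by (rule G.word_val_trivial_word[OF _ g])
  qed
  moreover have "g ` X \<subseteq> carrier G" using g by auto
  ultimately show ?thesis
    using presentation_embedding[of H X "\<lambda>x. x" "{}" G g] H grp that
    by (auto simp: free_basis_def)
qed

text \<open>Read with \<open>x\<close> as the loop that unwinds, the commutator of \<open>x\<close> and \<open>y\<close> crosses lifts of \<open>y\<close>
  at two different heights, so it is visible in an exponent sum.\<close>

lemma free_basis_not_commute: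
  assumes "free_basis G X" "x \<in> X" "y \<in> X" "x \<noteq> y"
  shows "x \<otimes>\<^bsub>G\<^esub> y \<noteq> y \<otimes>\<^bsub>G\<^esub> x"
proof
  assume comm: "x \<otimes>\<^bsub>G\<^esub> y = y \<otimes>\<^bsub>G\<^esub> x"
  have pres: "has_presentation G X (\<lambda>x. x) {}" using assms(1) by (simp add: free_basis_def)
  then interpret G: group G by (simp add: has_presentation_def)
  have X: "(\<lambda>x. x) ` X \<subseteq> carrier G" using pres by (simp add: has_presentation_def)
  have "x \<in> carrier G" "y \<in> carrier G" using X assms by auto
  then have "word_val G (\<lambda>x. x) [(x, True), (y, True)] = word_val G (\<lambda>x. x) [(y, True), (x, True)]"
    using comm by simp
  then have "word_val G (\<lambda>x. x) ([(x, True), (y, True)] @ inverse_word [(y, True), (x, True)]) = \<one>\<^bsub>G\<^esub>"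
    using G.word_val_eq_iff[of "[(x, True), (y, True)]" X "[(y, True), (x, True)]" "\<lambda>x. x"] X assms
    by (simp del: word_val_Cons)
  then have "[(x, True), (y, True)] @ inverse_word [(y, True), (x, True)] \<in> trivial_words {}"
    using pres assms by (simp add: has_presentation_def del: word_val_Cons)
  from read_lift_trivial_word[OF this, of x y "\<lambda>k. k" 0]
  have "[(1, True), (0, False)] \<in> (trivial_words {} :: int word set)"
    using assms(4) by (simp add: inverse_word_def)
  then show False using exponent_sum_trivial_word[of _ "1 :: int"] by force
qed

text \<open>With at most one basis element, the group consists of powers of one element.\<close>

lemma free_basis_obtain_two:
  assumes "free_basis G Y" "g \<in> carrier G" "h \<in> carrier G" "g \<otimes>\<^bsub>G\<^esub> h \<noteq> h \<otimes>\<^bsub>G\<^esub> g"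
  obtains a b where "a \<in> Y" "b \<in> Y" "a \<noteq> b"
proof (rule ccontr)
  assume "\<not> thesis"
  have pres: "has_presentation G Y (\<lambda>x. x) {}" using assms(1) by (simp add: free_basis_def)
  then interpret G: group G by (simp add: has_presentation_def)
  have Y: "Y \<subseteq> carrier G" and gen: "generate G Y = carrier G"
    using pres by (simp_all add: has_presentation_def)
  have "\<exists>y \<in> carrier G. Y \<subseteq> {y}"
  proof (cases "Y = {}")
    case False
    then obtain y where "y \<in> Y" by auto
    then show ?thesis using \<open>\<not> thesis\<close> that Y by blast
  qed auto
  then obtain y where y: "y \<in> carrier G" "Y \<subseteq> {y}" by auto
  have "carrier G \<subseteq> {y [^]\<^bsub>G\<^esub> (k :: int) | k. k \<in> UNIV}"
    using G.mono_generate[OF y(2)] gen G.generate_pow[OF y(1)] by auto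
  then obtain m n :: int where "g = y [^]\<^bsub>G\<^esub> m" "h = y [^]\<^bsub>G\<^esub> n"
    using assms(2,3) by blast
  then show False
    using assms(4) y(1) by (metis G.int_pow_mult add.commute)
qed


section \<open>Shortest homomorphisms and shortening quotients\<close>

lemma modular_group_subgroup:
  assumes "group L"
  shows "subgroup (modular_group L T) (AutoGroup L)"
proof -
  interpret L: group L by (rule assms)
  have "restrict (conj_elt L c) (carrier L) \<in> auto L" if c: "c \<in> carrier L" for c
  proof -
    have hom: "restrict (conj_elt L c) (carrier L) \<in> hom L L"
      using c by (auto simp: hom_def conj_elt_def L.m_assoc)
    have "bij_betw (restrict (conj_elt L c) (carrier L)) (carrier L) (carrier L)"
      using c by (intro bij_betwI[of _ _ _ "conj_elt L (inv\<^bsub>L\<^esub> c)"])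
        (auto simp: conj_elt_def L.m_assoc)
    then show ?thesis using hom by (simp add: auto_def Bij_def)
  qed
  then have "inner_auts L \<union> dehn_twists L T \<union> surface_auts L T \<union> abelian_auts L T \<subseteq> auto L"
    by (auto simp: inner_auts_def dehn_twists_def surface_auts_def abelian_auts_def
        extends_vertex_aut_def)
  then show ?thesis
    unfolding modular_group_def
    by (intro group.generate_is_subgroup[OF L.AutoGroup]) (simp add: AutoGroup_def)
qed

lemma modular_group_auto:
  assumes "group L" "\<phi> \<in> modular_group L T"
  shows "\<phi> \<in> hom L L" "bij_betw \<phi> (carrier L) (carrier L)"
  using subgroup.subset[OF modular_group_subgroup[OF assms(1)], of T] assms(2)
  by (auto simp: AutoGroup_def auto_def Bij_def)

lemma modular_group_compose:
  assumes "group L" "\<phi> \<in> modular_group L T" "\<psi> \<in> modular_group L T"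
  shows "compose (carrier L) \<phi> \<psi> \<in> modular_group L T"
proof -
  have sub: "modular_group L T \<subseteq> auto L"
    using subgroup.subset[OF modular_group_subgroup[OF assms(1)], of T] by (simp add: AutoGroup_def)
  have "\<phi> \<otimes>\<^bsub>AutoGroup L\<^esub> \<psi> \<in> modular_group L T"
    using subgroup.m_closed[OF modular_group_subgroup[OF assms(1)] assms(2,3)] .
  then show ?thesis
    using sub assms(2,3) by (simp add: AutoGroup_def BijGroup_def auto_def subset_iff)
qed

lemma (in group) conj_elt_hom: "c \<in> carrier G \<Longrightarrow> conj_elt G c \<in> hom G G"
  by (auto simp: hom_def conj_elt_def m_assoc)

lemma (in group) conj_elt_conj_elt:
  "\<lbrakk>c \<in> carrier G; d \<in> carrier G; x \<in> carrier G\<rbrakk> \<Longrightarrow>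
     conj_elt G c (conj_elt G d x) = conj_elt G (c \<otimes> d) x"
  by (simp add: conj_elt_def m_assoc inv_mult_group)

lemma (in group) conj_elt_eq_one_iff:
  "\<lbrakk>c \<in> carrier G; x \<in> carrier G\<rbrakk> \<Longrightarrow> conj_elt G c x = \<one> \<longleftrightarrow> x = \<one>"
  by (simp add: conj_elt_def mult_inv_eq_one_iff)

text \<open>Lengths are natural numbers, so the orbit of \<open>h\<close> under \<open>F\<close> and the modular group contains an
  element of minimal length.\<close>

lemma shortest_hom_exists:
  assumes "group F" "group L" "S \<subseteq> carrier L" "h \<in> hom L F"
  obtains c \<phi> where "c \<in> carrier F" "\<phi> \<in> modular_group L T"
    "shortest_hom F Y L T S (\<lambda>x. conj_elt F c (h (\<phi> x)))"
proof -
  interpret F: group F by fact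
  interpret L: group L by fact
  define N where "N = (\<lambda>(c, \<phi>). Max ((\<lambda>s. word_length F Y (conj_elt F c (h (\<phi> s)))) ` S))"
  have "(\<one>\<^bsub>F\<^esub>, \<one>\<^bsub>AutoGroup L\<^esub>) \<in> carrier F \<times> modular_group L T"
    using subgroup.one_closed[OF modular_group_subgroup[OF assms(2)]] by auto
  then obtain p where p: "p \<in> carrier F \<times> modular_group L T"
    and min: "\<And>q. q \<in> carrier F \<times> modular_group L T \<Longrightarrow> N p \<le> N q"
    using ex_has_least_nat[of "\<lambda>p. p \<in> carrier F \<times> modular_group L T" _ N] by blast
  obtain c \<phi> where [simp]: "p = (c, \<phi>)" by fastforce
  have c: "c \<in> carrier F" and \<phi>: "\<phi> \<in> modular_group L T" using p by auto
  note aut = modular_group_auto[OF assms(2)]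
  have "(\<lambda>x. conj_elt F c (h (\<phi> x))) \<in> hom L F"
    using hom_compose[OF hom_compose[OF aut(1)[OF \<phi>] assms(4)] F.conj_elt_hom[OF c]]
    by (simp add: comp_def)
  moreover have "N (c, \<phi>) \<le> Max ((\<lambda>s. word_length F Y (conj_elt F d (conj_elt F c (h (\<phi> (\<psi> s)))))) ` S)"
    if d: "d \<in> carrier F" and \<psi>: "\<psi> \<in> modular_group L T" for d \<psi>
  proof -
    have "conj_elt F d (conj_elt F c (h (\<phi> (\<psi> s)))) =
        conj_elt F (d \<otimes>\<^bsub>F\<^esub> c) (h (compose (carrier L) \<phi> \<psi> s))" if "s \<in> S" for s
    proof -
      have s: "s \<in> carrier L" using that assms(3) by auto
      then have "h (\<phi> (\<psi> s)) \<in> carrier F"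
        using aut(1)[OF \<phi>] aut(1)[OF \<psi>] assms(4) by (meson hom_in_carrier)
      then show ?thesis using s c d by (simp add: F.conj_elt_conj_elt compose_eq)
    qed
    moreover have "N (c, \<phi>) \<le> N (d \<otimes>\<^bsub>F\<^esub> c, compose (carrier L) \<phi> \<psi>)"
      using min[of "(d \<otimes>\<^bsub>F\<^esub> c, compose (carrier L) \<phi> \<psi>)"] c d \<phi> \<psi>
        modular_group_compose[OF assms(2) \<phi> \<psi>] by simp
    ultimately show ?thesis by (simp add: N_def cong: image_cong)
  qed
  ultimately have "shortest_hom F Y L T S (\<lambda>x. conj_elt F c (h (\<phi> x)))"
    by (simp add: shortest_hom_def N_def)
  then show ?thesis using that c \<phi> by blast
qed

lemma constant_stable_sequence: "h \<in> hom G F \<Longrightarrow> stable_sequence G F (\<lambda>n. h)"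
  by (auto simp: stable_sequence_def)

lemma constant_stable_kernel: "stable_kernel G F (\<lambda>n. h) = kernel G F h"
  by (auto simp: stable_kernel_def kernel_def)

text \<open>If \<open>F\<close> is commutative, every \<open>h n\<close> kills all commutators, so they lie in the stable kernel.\<close>

lemma stable_quotient_commutes:
  assumes "group L" "group F" "group Q" "\<eta> \<in> epi L Q" "\<And>n. h n \<in> hom L F"
    "kernel L Q \<eta> = stable_kernel L F h"
    and comm: "\<And>u v. \<lbrakk>u \<in> carrier F; v \<in> carrier F\<rbrakk> \<Longrightarrow> u \<otimes>\<^bsub>F\<^esub> v = v \<otimes>\<^bsub>F\<^esub> u"
    and xy: "x \<in> carrier Q" "y \<in> carrier Q"
  shows "x \<otimes>\<^bsub>Q\<^esub> y = y \<otimes>\<^bsub>Q\<^esub> x"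
proof -
  interpret L: group L by fact
  interpret F: group F by fact
  have \<eta>: "\<eta> \<in> hom L Q" "\<eta> ` carrier L = carrier Q" using assms(4) by (auto simp: epi_def)
  interpret \<eta>: group_hom L Q \<eta> using assms(1,3) \<eta> by (simp add: group_hom_def group_hom_axioms_def)
  obtain u v where uv: "u \<in> carrier L" "v \<in> carrier L" "x = \<eta> u" "y = \<eta> v"
    using xy \<eta>(2) by (metis imageE)
  have "h n (u \<otimes>\<^bsub>L\<^esub> v \<otimes>\<^bsub>L\<^esub> inv\<^bsub>L\<^esub> (v \<otimes>\<^bsub>L\<^esub> u)) = \<one>\<^bsub>F\<^esub>" for n
  proof -
    interpret h: group_hom L F "h n"
      using assms(1,2,5) by (simp add: group_hom_def group_hom_axioms_def)
    show ?thesis using uv comm[of "h n u" "h n v"] by (simp del: L.inv_mult_group)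
  qed
  then have "u \<otimes>\<^bsub>L\<^esub> v \<otimes>\<^bsub>L\<^esub> inv\<^bsub>L\<^esub> (v \<otimes>\<^bsub>L\<^esub> u) \<in> kernel L Q \<eta>"
    using uv assms(6) by (simp add: stable_kernel_def)
  then have "\<eta> u \<otimes>\<^bsub>Q\<^esub> \<eta> v \<otimes>\<^bsub>Q\<^esub> inv\<^bsub>Q\<^esub> (\<eta> v \<otimes>\<^bsub>Q\<^esub> \<eta> u) = \<one>\<^bsub>Q\<^esub>"
    using uv by (simp add: kernel_def)
  then show ?thesis using uv \<eta>.H.mult_inv_eq_one_iff by simp
qed

text \<open>A shortest map \<open>\<iota>\<^sub>c \<circ> f \<circ> \<eta> \<circ> \<phi>\<close> in the orbit of \<open>f \<circ> \<eta>\<close> has the same kernel as \<open>\<eta> \<circ> \<phi>\<close>, because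
  \<open>\<iota>\<^sub>c\<close> and \<open>f\<close> are injective. Used as a constant sequence, it makes the quotient by this kernel a
  shortening quotient, and \<open>\<eta> \<circ> \<phi>\<close> identifies that quotient with \<open>Q\<close>.\<close>

lemma shortening_quotient_of_embedding:
  assumes L: "group L" and F: "group F" and Q: "group Q" and U: "U \<subseteq> carrier L"
    and \<eta>: "\<eta> \<in> epi L Q" and f: "f \<in> hom Q F" "inj_on f (carrier Q)"
  obtains Q' :: "'a set monoid" and \<eta>' :: "'a \<Rightarrow> 'a set"
  where "shortening_quotient F Y L T U Q' \<eta>'" "SQ_isomorphic (L :: 'a monoid) T Q' \<eta>' Q \<eta>"
proof -
  interpret L: group L by (rule L)
  interpret F: group F by (rule F)
  interpret f: group_hom Q F f using F Q f by (simp add: group_hom_def group_hom_axioms_def)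
  have \<eta>_hom: "\<eta> \<in> hom L Q" and \<eta>_onto: "\<eta> ` carrier L = carrier Q" using \<eta> by (auto simp: epi_def)
  have "(\<lambda>x. f (\<eta> x)) \<in> hom L F" using hom_compose[OF \<eta>_hom f(1)] by (simp add: comp_def)
  then obtain c \<phi> where c: "c \<in> carrier F" and \<phi>: "\<phi> \<in> modular_group L T"
    and short: "shortest_hom F Y L T U (\<lambda>x. conj_elt F c (f (\<eta> (\<phi> x))))"
    by (rule shortest_hom_exists[OF F L U])
  note \<phi>_aut = modular_group_auto[OF L \<phi>]
  define \<theta> where "\<theta> = (\<lambda>x. \<eta> (\<phi> x))"
  have \<theta>_hom: "\<theta> \<in> hom L Q"
    using hom_compose[OF \<phi>_aut(1) \<eta>_hom] by (simp add: comp_def \<theta>_def)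
  have \<theta>_onto: "\<theta> ` carrier L = carrier Q"
    using \<eta>_onto bij_betw_imp_surj_on[OF \<phi>_aut(2)] image_image[of \<eta> \<phi> "carrier L"]
    by (simp add: \<theta>_def)
  interpret \<theta>: group_hom L Q \<theta> using L Q \<theta>_hom by (simp add: group_hom_def group_hom_axioms_def)
  define K where "K = kernel L Q \<theta>"
  interpret K: normal K L unfolding K_def by (rule \<theta>.normal_kernel)
  define Q' where "Q' = L Mod K"
  define \<eta>' where "\<eta>' = (\<lambda>x. K #>\<^bsub>L\<^esub> x)"
  have "conj_elt F c (f (\<theta> x)) = \<one>\<^bsub>F\<^esub> \<longleftrightarrow> \<theta> x = \<one>\<^bsub>Q\<^esub>" if x: "x \<in> carrier L" for x
  proof -
    have "conj_elt F c (f (\<theta> x)) = \<one>\<^bsub>F\<^esub> \<longleftrightarrow> f (\<theta> x) = f \<one>\<^bsub>Q\<^esub>"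
      unfolding f.hom_one
      by (intro F.conj_elt_eq_one_iff c f.hom_closed \<theta>.hom_closed x)
    also have "\<dots> \<longleftrightarrow> \<theta> x = \<one>\<^bsub>Q\<^esub>"
      by (intro inj_on_eq_iff[OF f(2)] \<theta>.hom_closed f.G.one_closed x)
    finally show ?thesis .
  qed
  then have ker: "kernel L F (\<lambda>x. conj_elt F c (f (\<theta> x))) = K"
    unfolding kernel_def K_def by blast
  have "\<eta>' x = \<one>\<^bsub>Q'\<^esub> \<longleftrightarrow> x \<in> K" if "x \<in> carrier L" for x
    unfolding \<eta>'_def Q'_def FactGroup_def monoid.simps
    using that L.coset_join1 L.coset_join2 K.subgroup_axioms K.subset by metis
  then have ker': "kernel L Q' \<eta>' = K"
    using K.subset by (auto simp: kernel_def)
  have "\<eta>' \<in> epi L Q'"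
    unfolding \<eta>'_def Q'_def epi_def
    using K.r_coset_hom_Mod by (auto simp: FactGroup_def RCOSETS_def)
  moreover have "group Q'" unfolding Q'_def by (rule K.factorgroup_is_group)
  ultimately have "shortening_quotient F Y L T U Q' \<eta>'"
    unfolding shortening_quotient_def
    using short ker ker' constant_stable_sequence[of "\<lambda>x. conj_elt F c (f (\<theta> x))" L F]
    by (intro conjI exI[of _ "\<lambda>n x. conj_elt F c (f (\<theta> x))"])
      (simp_all add: \<theta>_def constant_stable_kernel shortest_hom_def)
  moreover have "SQ_isomorphic L T Q' \<eta>' Q \<eta>"
    unfolding SQ_isomorphic_def
  proof (intro bexI[of _ "\<lambda>X. the_elem (\<theta> ` X)"] bexI[of _ \<phi>] ballI)
    show "(\<lambda>X. the_elem (\<theta> ` X)) \<in> iso Q' Q"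
      unfolding Q'_def K_def by (rule \<theta>.FactGroup_iso_set[OF \<theta>_onto])
    fix x assume x: "x \<in> carrier L"
    have "\<theta> y = \<theta> x" if "y \<in> K #>\<^bsub>L\<^esub> x" for y
      using that x unfolding r_coset_def K_def kernel_def by fastforce
    then have "\<theta> ` (K #>\<^bsub>L\<^esub> x) = {\<theta> x}"
      using L.rcos_self[OF x K.subgroup_axioms] by blast
    then show "\<eta> (\<phi> x) = the_elem (\<theta> ` \<eta>' x)" by (simp add: \<eta>'_def \<theta>_def)
  qed (rule \<phi>)
  ultimately show ?thesis using that by blast
qed

theorem mainTheorem3:
  fixes F :: "'f monoid" and Y :: "'f set"
    and L :: "'a monoid" and A B S :: "'a set" and z :: 'a
    and Q :: "'q monoid" and \<eta> :: "'a \<Rightarrow> 'q" and l :: nat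
  defines "T \<equiv> bass_serre_tree L A B"
  assumes F: "free_basis F Y" "finite Y"
    and L: "limit_group F L" "freely_indecomposable L"
    and splitting: "z \<in> carrier L" "amalgamated_product L A B (generate L {z})"
    and JSJ: "cyclic_JSJ L T"
    and rigid: "rigid_vertex L T (False, A)" "rigid_vertex L T (True, B)"
    and max_abelian: "maximal_abelian_in L (generate L {z}) A"
      "maximal_abelian_in L (generate L {z}) B"
    and S: "finite_generating_set L S"
    and Q: "free_of_rank Q l" "2 \<le> l"
    and \<eta>: "maximal_shortening_quotient F Y L T S Q \<eta>" "strict_quotient L T Q \<eta>"
  shows "\<forall>U. finite_generating_set L U \<longrightarrow>
    (\<exists>(Q' :: 'a set monoid) \<eta>'.
       shortening_quotient F Y L T U Q' \<eta>' \<and> SQ_isomorphic L T Q' \<eta>' Q \<eta>)"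
proof (intro allI impI)
  fix U assume U: "finite_generating_set L U"
  have F_group: "group F" using F(1) by (simp add: free_basis_def has_presentation_def)
  have L_group: "group L" using L(1) by (simp add: limit_group_def)
  obtain X where X: "free_basis Q X" "finite X" "card X = l" using Q(1) by (auto simp: free_of_rank_def)
  have X_carrier: "X \<subseteq> carrier Q" using X(1) by (auto simp: free_basis_def has_presentation_def)
  obtain x y where xy: "x \<in> X" "y \<in> X" "x \<noteq> y"
    using X(2,3) Q(2) card_le_Suc0_iff_eq[of X] by fastforce
  obtain h where Q_group: "group Q" and \<eta>_epi: "\<eta> \<in> epi L Q" and h: "\<And>n. h n \<in> hom L F"
    and ker: "kernel L Q \<eta> = stable_kernel L F h"
    using \<eta>(1) by (auto simp: maximal_shortening_quotient_def shortening_quotient_def stable_sequence_def)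
  have "\<exists>u v. u \<in> carrier F \<and> v \<in> carrier F \<and> u \<otimes>\<^bsub>F\<^esub> v \<noteq> v \<otimes>\<^bsub>F\<^esub> u"
    using stable_quotient_commutes[OF L_group F_group Q_group \<eta>_epi h ker, of x y]
      free_basis_not_commute[OF X(1) xy] xy X_carrier by blast
  then obtain a b where ab: "a \<in> Y" "b \<in> Y" "a \<noteq> b"
    using free_basis_obtain_two[OF F(1)] by metis
  obtain f where f: "f \<in> hom Q F" "inj_on f (carrier Q)"
    using free_group_embedding[OF X(1) countable_finite[OF X(2)] F(1) ab] by blast
  have "U \<subseteq> carrier L" using U by (simp add: finite_generating_set_def)
  from shortening_quotient_of_embedding[OF L_group F_group Q_group this \<eta>_epi f, of Y T]
  show "\<exists>(Q' :: 'a set monoid) \<eta>'.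
      shortening_quotient F Y L T U Q' \<eta>' \<and> SQ_isomorphic L T Q' \<eta>' Q \<eta>"
    by blast
qed

end
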